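(* Let $\mathcal H$ be a real Hilbert space, and let $T\colon\mathcal H\to\mathcal H$ and $U\colon\mathcal H\to\mathcal H$ be $\lambda$- and $\mu$-relaxed cutters, respectively, where $\lambda,\mu>0$. Assume that $\lambda\mu<4$ and $\operatorname{Fix}T\cap\operatorname{Fix}U\neq\emptyset$. Then, for each $x\in\mathcal H$ such that $x\notin\operatorname{Fix}T\cap\operatorname{Fix}U$, we have $$\|U(T(x))-x\|\ \ge\ \left(\frac{|\alpha|}{1+\beta\sqrt\nu}\right)^2\frac{\max\{\|T(x)-x\|^2,\ \|U(T(x))-T(x)\|^2\}}{d(x,\operatorname{Fix}T\cap\operatorname{Fix}U)},$$ where $$\nu:=\frac{4(\lambda+\mu-\lambda\mu)}{4-\lambda\mu},\quad \alpha:=\sqrt{\tfrac1\lambda-\tfrac1\nu}-\sqrt{\tfrac1\mu-\tfrac1\nu}\neq0\quad\text{and}\quad \beta:=\max\left\{\sqrt{\tfrac1\lambda-\tfrac1\nu},\ \sqrt{\tfrac1\mu-\tfrac1\nu}\right\}>0.$$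
   Context: $\operatorname{Fix}T:=\{x\in\mathcal H: T(x)=x\}$; $d(x,A):=\inf_{a\in A}\|x-a\|$. An operator $S\colon\mathcal H\to\mathcal H$ with $\operatorname{Fix}S\neq\emptyset$ is a cutter if $\langle z-S(x),x-S(x)\rangle\le 0$ for all $x\in\mathcal H$ and all $z\in\operatorname{Fix}S$. For $\lambda>0$, a $\lambda$-relaxed cutter is an operator of the form $\operatorname{Id}+\lambda(S-\operatorname{Id})$ with $S$ a cutter (it has the same fixed point set as $S$; this set is closed and convex). For $\lambda,\mu>0$ with $\lambda\mu<4$ one has $\nu\ge\max\{\lambda,\mu\}>0$, so the square roots are well defined.
   Formalization: The claim α ≠ 0 is asserted only for λ ≠ μ, since α = 0 whenever λ = μ (e.g. λ = μ = 1); the inequality and β > 0 are stated for all λ, μ > 0 with λμ < 4. *)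

theory Defs
  imports "HOL-Analysis.Analysis"
begin

definition Fix :: "('a \<Rightarrow> 'a) \<Rightarrow> 'a set" where
  "Fix T = {x. T x = x}"

definition cutter :: "('a::real_inner \<Rightarrow> 'a) \<Rightarrow> bool" where
  "cutter S \<longleftrightarrow> Fix S \<noteq> {} \<and> (\<forall>x. \<forall>z\<in>Fix S. (z - S x) \<bullet> (x - S x) \<le> 0)"

definition relaxed_cutter :: "real \<Rightarrow> ('a::real_inner \<Rightarrow> 'a) \<Rightarrow> bool" where
  "relaxed_cutter l T \<longleftrightarrow> l > 0 \<and> (\<exists>S. cutter S \<and> T = (\<lambda>x. x + l *\<^sub>R (S x - x)))"

end

theory Submission
  imports Defs
begin

text \<open>
  With \<open>a = T x - x\<close> and \<open>b = U (T x) - T x\<close>, the two relaxed cutter inequalities at a common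
  fixed point \<open>z\<close> add up to \<open>(z - x) \<bullet> (a + b) \<ge> |a|^2/l + |b|^2/m + a \<bullet> b\<close>. The number
  \<open>\<nu>\<close> is chosen so that the right-hand side equals \<open>|a + b|^2/\<nu> + |p a - q b|^2\<close> with
  \<open>p^2 = 1/l - 1/\<nu>\<close> and \<open>q^2 = 1/m - 1/\<nu>\<close>. Hence both \<open>|a + b|\<close> and \<open>|p a - q b|\<close> are controlled by
  \<open>R = |z - x| |a + b|\<close>, and so are \<open>(p + q) a\<close> and \<open>(p + q) b\<close>, which are linear combinations of
  \<open>a + b\<close> and \<open>p a - q b\<close>.
\<close>

lemma Fix_relaxation:
  fixes S :: "'a::real_vector \<Rightarrow> 'a"
  assumes "l \<noteq> 0"
  shows "Fix (\<lambda>x. x + l *\<^sub>R (S x - x)) = Fix S"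
  using assms by (auto simp: Fix_def)

text \<open>With \<open>c = S x - x\<close> the cutter inequality expands to
  \<open>c \<bullet> c \<le> (z - x) \<bullet> c\<close>; multiplying by \<open>l\<close> and using
  \<open>T x - x = l *\<^sub>R c\<close> leaves a factor \<open>1 / l\<close> on the squared
  norm.\<close>

lemma relaxed_cutter_inner_ge:
  assumes "relaxed_cutter l T" and "z \<in> Fix T"
  shows "(norm (T x - x))\<^sup>2 / l \<le> (z - x) \<bullet> (T x - x)"
proof -
  from assms obtain S where l: "l > 0" and S: "cutter S" and T: "T = (\<lambda>x. x + l *\<^sub>R (S x - x))"
    by (auto simp: relaxed_cutter_def)
  define c where "c = S x - x"
  have "z \<in> Fix S"
    using assms(2) l by (simp add: T Fix_relaxation)
  with S have "(z - S x) \<bullet> (x - S x) \<le> 0"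
    by (simp add: cutter_def)
  also have "(z - S x) \<bullet> (x - S x) = c \<bullet> c - (z - x) \<bullet> c"
    by (simp add: c_def algebra_simps inner_commute)
  finally have "c \<bullet> c \<le> (z - x) \<bullet> c"
    by simp
  moreover have "T x - x = l *\<^sub>R c"
    by (simp add: T c_def)
  ultimately show ?thesis
    using l by (simp add: dot_square_norm power_mult_distrib power2_eq_square)
qed

lemma relaxation_sum_gt_prod:
  fixes l m :: real
  assumes "l > 0" "m > 0" "l * m < 4"
  shows "l + m > l * m"
proof -
  \<comment> \<open>The geometric mean enters here: \<open>4 * (l * m)\<close> lies strictly above
    \<open>(l * m)\<^sup>2\<close> because \<open>l * m < 4\<close>, and below
    \<open>(l + m)\<^sup>2\<close> by AM-GM.\<close>
  have "(l * m)\<^sup>2 < 4 * (l * m)"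
    using assms by (simp add: power2_eq_square)
  also have "\<dots> \<le> (l + m)\<^sup>2"
    using zero_le_power2[of "l - m"] by (simp add: power2_eq_square algebra_simps)
  finally show ?thesis
    using assms by (intro power2_less_imp_less[of "l * m" "l + m"]) auto
qed

text \<open>These factorisations show that \<open>(1 / l - 1 / \<nu>) * (1 / m - 1 / \<nu>)\<close>
  is the square of \<open>1 / \<nu> - 1 / 2\<close>. So subtracting
  \<open>(norm (a + b))\<^sup>2 / \<nu>\<close> makes the quadratic form in \<open>a\<close>,
  \<open>b\<close> degenerate, and a single square remains.\<close>

lemma
  fixes l m \<nu> :: real
  assumes "l > 0" "m > 0" "l * m < 4"
    and \<nu>: "\<nu> = 4 * (l + m - l * m) / (4 - l * m)"
  shows nu_pos: "\<nu> > 0"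
    and inverse_minus_inverse_nu: "1 / l - 1 / \<nu> = m * (2 - l)\<^sup>2 / (4 * l * (l + m - l * m))"
    and inverse_nu_minus_half:
      "1 / \<nu> - 1 / 2 = (2 - l) * (2 - m) / (4 * (l + m - l * m))"
proof -
  define D where "D = l + m - l * m"
  have D: "D > 0"
    using relaxation_sum_gt_prod[OF assms(1-3)] by (simp add: D_def)
  show "\<nu> > 0"
    using D assms(3) by (simp add: \<nu> D_def)
  have inv: "1 / \<nu> = (4 - l * m) / (4 * D)"
    by (simp add: \<nu> D_def)
  have "1 / l - 1 / \<nu> = (4 * D - l * (4 - l * m)) / (4 * l * D)"
    unfolding inv using D assms by (simp add: field_simps)
  also have "4 * D - l * (4 - l * m) = m * (2 - l)\<^sup>2"
    by (simp add: D_def power2_eq_square algebra_simps)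
  finally show "1 / l - 1 / \<nu> = m * (2 - l)\<^sup>2 / (4 * l * (l + m - l * m))"
    by (simp add: D_def)
  have "1 / \<nu> - 1 / 2 = (4 - l * m - 2 * D) / (4 * D)"
    unfolding inv using D by (simp add: field_simps)
  also have "4 - l * m - 2 * D = (2 - l) * (2 - m)"
    by (simp add: D_def algebra_simps)
  finally show "1 / \<nu> - 1 / 2 = (2 - l) * (2 - m) / (4 * (l + m - l * m))"
    by (simp add: D_def)
qed

lemma inverse_nu_le:
  fixes l m \<nu> :: real
  assumes "l > 0" "m > 0" "l * m < 4"
    and "\<nu> = 4 * (l + m - l * m) / (4 - l * m)"
  shows "1 / \<nu> \<le> 1 / l"
  using inverse_minus_inverse_nu[OF assms] relaxation_sum_gt_prod[OF assms(1-3)] assms(1,2)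
  by (smt (verit) divide_nonneg_pos mult_nonneg_nonneg mult_pos_pos zero_le_power2)

text \<open>Both differences are nonnegative multiples of \<open>(2 - l)\<^sup>2\<close> and
  \<open>(2 - m)\<^sup>2\<close>; they vanish together only at \<open>l = m = 2\<close>, where
  \<open>l * m = 4\<close>.\<close>

lemma beta_pos:
  fixes l m \<nu> :: real
  assumes "l > 0" "m > 0" "l * m < 4"
    and \<nu>: "\<nu> = 4 * (l + m - l * m) / (4 - l * m)"
  shows "1 / l - 1 / \<nu> > 0 \<or> 1 / m - 1 / \<nu> > 0"
proof (rule ccontr)
  assume "\<not> ?thesis"
  then have "1 / l - 1 / \<nu> = 0" "1 / m - 1 / \<nu> = 0"
    using inverse_nu_le[OF assms] inverse_nu_le[of m l \<nu>] assms
    by (auto simp: ac_simps)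
  moreover have "1 / m - 1 / \<nu> = l * (2 - m)\<^sup>2 / (4 * m * (m + l - m * l))"
    using assms by (intro inverse_minus_inverse_nu) (simp_all add: ac_simps)
  ultimately have "l = 2" "m = 2"
    using inverse_minus_inverse_nu[OF assms] relaxation_sum_gt_prod[OF assms(1-3)] assms
    by (auto simp: ac_simps)
  with assms(3) show False
    by simp
qed

text \<open>The condition on \<open>p * q\<close> makes the two mixed terms,
  \<open>2 / \<nu>\<close> and \<open>- 2 * (p * q)\<close>, add up to 1.\<close>

lemma completed_square:
  fixes a b :: "'a::real_inner" and p q r s \<nu> :: real
  assumes "p\<^sup>2 = r - 1 / \<nu>" "q\<^sup>2 = s - 1 / \<nu>" "p * q = 1 / \<nu> - 1 / 2"
  shows "(norm (a + b))\<^sup>2 / \<nu> + (norm (p *\<^sub>R a - q *\<^sub>R b))\<^sup>2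
    = r * (norm a)\<^sup>2 + s * (norm b)\<^sup>2 + a \<bullet> b"
proof -
  have "(norm (p *\<^sub>R a - q *\<^sub>R b))\<^sup>2 = p\<^sup>2 * (a \<bullet> a) - 2 * (p * q) * (a \<bullet> b) + q\<^sup>2 * (b \<bullet> b)"
    by (simp add: dot_square_norm[symmetric] algebra_simps inner_commute power2_eq_square[of p] power2_eq_square[of q])
  also have "\<dots> = (r - 1 / \<nu>) * (a \<bullet> a) - 2 * (1 / \<nu> - 1 / 2) * (a \<bullet> b) + (s - 1 / \<nu>) * (b \<bullet> b)"
    by (simp only: assms)
  finally show ?thesis
    by (simp add: power2_norm_eq_inner algebra_simps inner_commute add_divide_distrib)
qed

lemma two_combinations_bound:
  fixes a b :: "'a::real_normed_vector" and p q \<nu> R \<beta> :: real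
  assumes R: "(norm (a + b))\<^sup>2 / \<nu> + (norm (p *\<^sub>R a - q *\<^sub>R b))\<^sup>2 \<le> R"
    and "\<nu> > 0" and "\<bar>p\<bar> \<le> \<beta>" and "\<bar>q\<bar> \<le> \<beta>"
  shows "\<bar>p + q\<bar> * norm a \<le> (1 + \<beta> * sqrt \<nu>) * sqrt R"
    and "\<bar>p + q\<bar> * norm b \<le> (1 + \<beta> * sqrt \<nu>) * sqrt R"
proof -
  define u v where "u = a + b" and "v = p *\<^sub>R a - q *\<^sub>R b"
  have v: "norm v \<le> sqrt R"
    using R \<open>\<nu> > 0\<close> by (intro real_le_rsqrt) (smt (verit) v_def divide_nonneg_pos zero_le_power2)
  have "(norm u)\<^sup>2 / \<nu> \<le> R"
    using R by (smt (verit) u_def zero_le_power2)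
  then have "norm u \<le> sqrt (\<nu> * R)"
    using \<open>\<nu> > 0\<close> by (intro real_le_rsqrt) (simp add: field_simps)
  then have u: "norm u \<le> sqrt \<nu> * sqrt R"
    by (simp add: real_sqrt_mult)
  have *: "norm (c *\<^sub>R u) \<le> \<beta> * (sqrt \<nu> * sqrt R)" if "\<bar>c\<bar> \<le> \<beta>" for c
    using that u by (simp add: mult_mono)
  \<comment> \<open>Eliminating \<open>b\<close>: in the constant, 1 comes from \<open>v\<close> and
    \<open>\<beta> * sqrt \<nu>\<close> from \<open>q *\<^sub>R u\<close>.\<close>
  have "(p + q) *\<^sub>R a = v + q *\<^sub>R u"
    by (simp add: u_def v_def algebra_simps)
  then have "norm ((p + q) *\<^sub>R a) \<le> norm v + norm (q *\<^sub>R u)"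
    by (simp add: norm_triangle_ineq del: norm_scaleR)
  with v *[OF assms(4)] show "\<bar>p + q\<bar> * norm a \<le> (1 + \<beta> * sqrt \<nu>) * sqrt R"
    unfolding norm_scaleR distrib_right by (simp add: mult.assoc)
  have "(p + q) *\<^sub>R b = p *\<^sub>R u - v"
    by (simp add: u_def v_def algebra_simps)
  then have "norm ((p + q) *\<^sub>R b) \<le> norm (p *\<^sub>R u) + norm v"
    by (simp add: norm_triangle_ineq4 del: norm_scaleR)
  with v *[OF assms(3)] show "\<bar>p + q\<bar> * norm b \<le> (1 + \<beta> * sqrt \<nu>) * sqrt R"
    unfolding norm_scaleR distrib_right by (simp add: mult.assoc)
qed

text \<open>The estimate for one common fixed point \<open>z\<close>, with \<open>dist x z\<close>
  kept as a factor so that it can be minimised over \<open>z\<close> afterwards.\<close>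

lemma relaxed_cutters_displacement_bound:
  fixes T U :: "'a::real_inner \<Rightarrow> 'a" and l m \<nu> \<alpha> \<beta> :: real
  assumes T: "relaxed_cutter l T" and U: "relaxed_cutter m U"
    and "l > 0" "m > 0" and "l * m < 4"
    and z: "z \<in> Fix T \<inter> Fix U"
    and \<nu>: "\<nu> = 4 * (l + m - l * m) / (4 - l * m)"
    and \<alpha>: "\<alpha> = sqrt (1 / l - 1 / \<nu>) - sqrt (1 / m - 1 / \<nu>)"
    and \<beta>: "\<beta> = max (sqrt (1 / l - 1 / \<nu>)) (sqrt (1 / m - 1 / \<nu>))"
  shows "(\<bar>\<alpha>\<bar> / (1 + \<beta> * sqrt \<nu>))\<^sup>2 * max ((norm (T x - x))\<^sup>2) ((norm (U (T x) - T x))\<^sup>2)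
    \<le> norm (U (T x) - x) * dist x z"
proof -
  define a b where "a = T x - x" and "b = U (T x) - T x"
  define p q0 where "p = sqrt (1 / l - 1 / \<nu>)" and "q0 = sqrt (1 / m - 1 / \<nu>)"
  define R where "R = norm (a + b) * dist x z"
  \<comment> \<open>\<open>\<nu>\<close> is symmetric in \<open>l\<close> and \<open>m\<close>, so
    the facts about \<open>1 / l - 1 / \<nu>\<close> also apply with the roles exchanged.\<close>
  have \<nu>': "\<nu> = 4 * (m + l - m * l) / (4 - m * l)" and ml: "m * l < 4"
    using \<nu> assms(5) by (simp_all add: ac_simps)
  note lm = assms(3,4)
  have "\<nu> > 0"
    using nu_pos[OF lm assms(5) \<nu>] .
  have p: "p\<^sup>2 = 1 / l - 1 / \<nu>" "p \<ge> 0"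
    using inverse_nu_le[OF lm assms(5) \<nu>] by (simp_all add: p_def)
  have q0: "q0\<^sup>2 = 1 / m - 1 / \<nu>" "q0 \<ge> 0"
    using inverse_nu_le[OF lm(2,1) ml \<nu>'] by (simp_all add: q0_def)
  define D where "D = l + m - l * m"
  have D: "D > 0"
    using relaxation_sum_gt_prod[OF lm assms(5)] by (simp add: D_def)
  have "(p * q0)\<^sup>2 = (m * (2 - l)\<^sup>2 / (4 * l * D)) * (l * (2 - m)\<^sup>2 / (4 * m * D))"
    unfolding power_mult_distrib p q0 inverse_minus_inverse_nu[OF lm assms(5) \<nu>]
      inverse_minus_inverse_nu[OF lm(2,1) ml \<nu>'] by (simp add: D_def ac_simps)
  also have "\<dots> = ((2 - l) * (2 - m) / (4 * D))\<^sup>2"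
    using D lm by (simp add: field_simps power2_eq_square)
  also have "\<dots> = (1 / \<nu> - 1 / 2)\<^sup>2"
    by (simp add: inverse_nu_minus_half[OF lm assms(5) \<nu>] D_def)
  finally have "p * q0 = 1 / \<nu> - 1 / 2 \<or> p * q0 = - (1 / \<nu> - 1 / 2)"
    by (simp only: power2_eq_iff)
  \<comment> \<open>The mixed term fixes the sign of the second root, which is negative when exactly one of
    \<open>l\<close>, \<open>m\<close> exceeds 2; \<open>|\<alpha>| \<le> |p + q|\<close> holds for either sign.\<close>
  then obtain q where q: "\<bar>q\<bar> = q0" "p * q = 1 / \<nu> - 1 / 2"
    using q0(2) by (metis abs_minus_cancel abs_of_nonneg minus_minus mult_minus_right)
  then have q2: "q\<^sup>2 = 1 / m - 1 / \<nu>"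
    using q0(1) by (metis power2_abs)
  have "(norm (a + b))\<^sup>2 / \<nu> + (norm (p *\<^sub>R a - q *\<^sub>R b))\<^sup>2
      = (norm a)\<^sup>2 / l + (norm b)\<^sup>2 / m + a \<bullet> b"
    using completed_square[OF p(1) q2 q(2), of a b] by simp
  also have "\<dots> \<le> (z - x) \<bullet> a + (z - T x) \<bullet> b + a \<bullet> b"
    using relaxed_cutter_inner_ge[OF T, of z x] relaxed_cutter_inner_ge[OF U, of z "T x"] z
    by (simp add: a_def b_def)
  \<comment> \<open>Since \<open>z - T x = (z - x) - a\<close>, the term
    \<open>a \<bullet> b\<close> cancels.\<close>
  also have "\<dots> = (z - x) \<bullet> (a + b)"
    by (simp add: a_def algebra_simps)
  also have "\<dots> \<le> norm (z - x) * norm (a + b)"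
    by (rule norm_cauchy_schwarz)
  also have "\<dots> = R"
    by (simp add: R_def dist_norm norm_minus_commute)
  finally have *: "(norm (a + b))\<^sup>2 / \<nu> + (norm (p *\<^sub>R a - q *\<^sub>R b))\<^sup>2 \<le> R" .
  have pq: "\<bar>p\<bar> \<le> \<beta>" "\<bar>q\<bar> \<le> \<beta>"
    using p q q0 by (auto simp: \<beta> p_def q0_def)
  have \<alpha>_le: "\<bar>\<alpha>\<bar> \<le> \<bar>p + q\<bar>"
    using p(2) q(1) by (simp add: \<alpha> p_def[symmetric] q0_def[symmetric])
  define C where "C = 1 + \<beta> * sqrt \<nu>"
  have "\<beta> \<ge> 0"
    using pq by linarith
  then have C: "C > 0"
    using \<open>\<nu> > 0\<close> by (simp add: C_def add_pos_nonneg)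
  have R: "R \<ge> 0"
    by (simp add: R_def)
  have bound: "(\<bar>\<alpha>\<bar> / C)\<^sup>2 * (norm c)\<^sup>2 \<le> R" if "\<bar>p + q\<bar> * norm c \<le> C * sqrt R" for c :: 'a
  proof -
    have "\<bar>\<alpha>\<bar> * norm c \<le> C * sqrt R"
      using mult_right_mono[OF \<alpha>_le norm_ge_zero[of c]] that by linarith
    then have "\<bar>\<alpha>\<bar> / C * norm c \<le> sqrt R"
      using C by (simp add: field_simps)
    then have "(\<bar>\<alpha>\<bar> / C * norm c)\<^sup>2 \<le> (sqrt R)\<^sup>2"
      using C by (intro power_mono) auto
    then show ?thesis
      using R by (simp only: power_mult_distrib real_sqrt_pow2)
  qed
  have "(\<bar>\<alpha>\<bar> / C)\<^sup>2 * max ((norm a)\<^sup>2) ((norm b)\<^sup>2) \<le> R"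
    using bound[of a] bound[of b] two_combinations_bound[OF * \<open>\<nu> > 0\<close> pq]
    by (auto simp: C_def max_def)
  then show ?thesis
    by (simp add: C_def R_def a_def b_def)
qed

lemma le_mult_infdist:
  assumes "A \<noteq> {}" and "c \<ge> 0" and "\<And>z. z \<in> A \<Longrightarrow> K \<le> c * dist x z"
  shows "K \<le> c * infdist x A"
proof (cases "c = 0")
  case True
  then show ?thesis
    using assms by auto
next
  case False
  then have c: "c > 0"
    using assms(2) by simp
  then have "K / c \<le> infdist x A"
    unfolding infdist_notempty[OF assms(1)] using assms(1,3)
    by (intro cINF_greatest) (auto simp: field_simps)
  with c show ?thesis
    by (simp add: field_simps)
qed

text \<open>For \<open>l = m\<close> the two roots coincide and \<open>\<alpha> = 0\<close>, which
  is why \<open>\<alpha> \<noteq> 0\<close> is claimed under \<open>l \<noteq> m\<close>; the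
  right-hand side of the estimate is then 0.\<close>

theorem lemma3p1:
  fixes T U :: "'a::{real_inner,complete_space} \<Rightarrow> 'a"
    and l m \<nu> \<alpha> \<beta> :: real
  assumes "l > 0" and "m > 0"
    and "relaxed_cutter l T" and "relaxed_cutter m U"
    and "l * m < 4"
    and "Fix T \<inter> Fix U \<noteq> {}"
    and "\<nu> = 4 * (l + m - l * m) / (4 - l * m)"
    and "\<alpha> = sqrt (1 / l - 1 / \<nu>) - sqrt (1 / m - 1 / \<nu>)"
    and "\<beta> = max (sqrt (1 / l - 1 / \<nu>)) (sqrt (1 / m - 1 / \<nu>))"
  shows "(l \<noteq> m \<longrightarrow> \<alpha> \<noteq> 0) \<and> \<beta> > 0 \<and>
    (\<forall>x. x \<notin> Fix T \<inter> Fix U \<longrightarrow>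
      norm (U (T x) - x) \<ge>
        (\<bar>\<alpha>\<bar> / (1 + \<beta> * sqrt \<nu>))\<^sup>2 *
        (max ((norm (T x - x))\<^sup>2) ((norm (U (T x) - T x))\<^sup>2) / infdist x (Fix T \<inter> Fix U)))"
proof (intro conjI impI allI)
  note hyps = assms(1,2,5,7)
  show "\<alpha> \<noteq> 0" if "l \<noteq> m"
    using that assms(1,2,8) by simp
  show "\<beta> > 0"
    using beta_pos[OF hyps] by (auto simp: assms(9) less_max_iff_disj)
  fix x
  let ?K = "(\<bar>\<alpha>\<bar> / (1 + \<beta> * sqrt \<nu>))\<^sup>2 * max ((norm (T x - x))\<^sup>2) ((norm (U (T x) - T x))\<^sup>2)"
  let ?d = "infdist x (Fix T \<inter> Fix U)"
  have "?K \<le> norm (U (T x) - x) * ?d"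
    using relaxed_cutters_displacement_bound[OF assms(3,4,1,2,5) _ assms(7-9)]
    by (intro le_mult_infdist[OF assms(6)]) auto
  \<comment> \<open>A quotient by zero has value 0, so the case \<open>?d = 0\<close> reduces to
    nonnegativity of the norm.\<close>
  then have "?K / ?d \<le> norm (U (T x) - x)"
  proof (cases "?d = 0")
    case False
    then have "?d > 0"
      using infdist_nonneg[of x "Fix T \<inter> Fix U"] by linarith
    then show ?thesis
      using \<open>?K \<le> norm (U (T x) - x) * ?d\<close> by (rule mult_imp_div_pos_le)
  qed simp
  then show "norm (U (T x) - x) \<ge> (\<bar>\<alpha>\<bar> / (1 + \<beta> * sqrt \<nu>))\<^sup>2 *
      (max ((norm (T x - x))\<^sup>2) ((norm (U (T x) - T x))\<^sup>2) / ?d)"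
    by simp
qed

end
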